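(* Let $0<a<1$ and $b<1$ be real. For all $n,x,y\in\mathbb{Z}_{\ge0}$ the little $0$-Jacobi functions satisfy the product formula $$p_n^{a,b;0}(x)\,p_n^{a,b;0}(y)=\sum_{z=0}^\infty c_{x,y,z}^{a,b,0}\,p_n^{a,b;0}(z),$$ where $$c_{x,y,z}^{a,b,0}=\begin{cases} \delta_{z,\min(x,y)}&\text{if }x\ne y,\\ \dfrac{1-2a+ab}{1-a}&\text{if }x=y=z=0,\\ (1-b)a^z&\text{if }0=x=y<z,\\ 0&\text{if }x=y>z,\\ \dfrac{1-2a}{1-a}&\text{if }x=y=z>0,\\ a^{z-x}&\text{if }0<x=y<z. \end{cases}$$ In particular, $p_n^{a,b;0}(x)\,p_n^{a,b;0}(y)=p_n^{a,b;0}(\min(x,y))$ if $x\ne y$. Moreover, under the constraints $0<a<1$, $b<1$, one has $c_{x,y,z}^{a,b,0}\ge0$ for all $x,y,z\in\mathbb{Z}_{\ge0}$ if and only if $$0<a\le\tfrac12\quad\text{and}\quad 2-a^{-1}\le b<1.$$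
   Context: For real $a,b$ with $0<a<1$, $b<1$, the little $0$-Jacobi functions $p_n^{a,b;0}:\mathbb{Z}_{\ge0}\to\mathbb{R}$ ($n\in\mathbb{Z}_{\ge0}$) (the $q\downarrow0$ limits of little $q$-Jacobi polynomials) are given by: $p_0^{a,b;0}(x)=1$ for all $x$; $p_1^{a,b;0}(0)=-\frac{a(1-b)}{1-a}$ and $p_1^{a,b;0}(x)=1$ for $x>0$; and for $n\ge2$, $p_n^{a,b;0}(x)=0$ if $0\le x<n-1$, $p_n^{a,b;0}(n-1)=-\frac{a}{1-a}$, and $p_n^{a,b;0}(x)=1$ if $x>n-1$. Here $\delta_{i,j}$ is the Kronecker delta. *)

theory Defs
  imports Complex_Main
begin

(* little0_Jacobi a b n x is p_n^{a,b;0}(x). *)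
definition little0_Jacobi :: "real \<Rightarrow> real \<Rightarrow> nat \<Rightarrow> nat \<Rightarrow> real" where
  "little0_Jacobi a b n x =
     (if n = 0 then 1
      else if n = 1 then (if x = 0 then - (a * (1 - b) / (1 - a)) else 1)
      else if x < n - 1 then 0
      else if x = n - 1 then - (a / (1 - a))
      else 1)"

(* little0_Jacobi_coeff a b x y z is c_{x,y,z}^{a,b,0}. *)
definition little0_Jacobi_coeff :: "real \<Rightarrow> real \<Rightarrow> nat \<Rightarrow> nat \<Rightarrow> nat \<Rightarrow> real" where
  "little0_Jacobi_coeff a b x y z =
     (if x \<noteq> y then (if z = min x y then 1 else 0)
      else if z < x then 0
      else if x = 0 then
        (if z = 0 then (1 - 2 * a + a * b) / (1 - a) else (1 - b) * a ^ z)
      else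
        (if z = x then (1 - 2 * a) / (1 - a) else a ^ (z - x)))"

end

theory Submission
  imports Defs
begin

text \<open>
  The functions and the coefficients treat the origin differently only through the factor
  \<open>w\<close>, which is \<open>1 - b\<close> at \<open>0\<close> and \<open>1\<close> elsewhere: the function of index \<open>m + 1\<close> jumps
  from \<open>0\<close> to \<open>1\<close> through the value \<open>- w(m) a / (1 - a)\<close> at \<open>m\<close>, and \<open>c\<close> on the diagonal
  is \<open>w(x) a\<^sup>z\<^sup>-\<^sup>x\<close> for \<open>z > x\<close>, with total mass \<open>1\<close>. The product formula is then a
  geometric series in each of the cases \<open>m < x\<close>, \<open>m = x\<close>, \<open>m > x\<close>.
\<close>

definition origin_weight :: "real \<Rightarrow> nat \<Rightarrow> real" where
  "origin_weight b x = (if x = 0 then 1 - b else 1)"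

lemma little0_Jacobi_0: "little0_Jacobi a b 0 x = 1"
  by (simp add: little0_Jacobi_def)

lemma little0_Jacobi_Suc:
  "little0_Jacobi a b (Suc m) x =
     (if x < m then 0 else if x = m then - (origin_weight b m * a / (1 - a)) else 1)"
  by (auto simp: little0_Jacobi_def origin_weight_def)

lemma little0_Jacobi_coeff_diag:
  assumes "a < 1"
  shows "little0_Jacobi_coeff a b x x z =
     (if z < x then 0
      else if z = x then 1 - origin_weight b x * a / (1 - a)
      else origin_weight b x * a ^ (z - x))"
  using assms by (auto simp: little0_Jacobi_coeff_def origin_weight_def field_simps)

text \<open>For \<open>n > 0\<close>, a nonzero value at \<open>x\<close> forces
  \<open>x \<ge> n - 1\<close>, hence \<open>y > n - 1\<close>, where the function is already
  \<open>1\<close>.\<close>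

lemma little0_Jacobi_mult_less:
  assumes "x < y"
  shows "little0_Jacobi a b n x * little0_Jacobi a b n y = little0_Jacobi a b n x"
  using assms by (cases n) (auto simp: little0_Jacobi_0 little0_Jacobi_Suc)

lemma little0_Jacobi_mult:
  assumes "x \<noteq> y"
  shows "little0_Jacobi a b n x * little0_Jacobi a b n y = little0_Jacobi a b n (min x y)"
  using assms little0_Jacobi_mult_less[of x y a b n] little0_Jacobi_mult_less[of y x a b n]
  by (cases "x < y") (auto simp: min_def mult.commute)

lemma geometric_tail_sums:
  fixes a :: real
  assumes "0 < a" "a < 1"
  shows "(\<lambda>z. if z < m then 0 else a ^ (z - m)) sums (1 / (1 - a))"
proof -
  have "(\<lambda>i. a ^ i) sums (1 / (1 - a))"
    using assms by (intro geometric_sums) auto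
  then have "(\<lambda>i. if i + m < m then 0 else a ^ (i + m - m)) sums (1 / (1 - a))"
    by simp
  then show ?thesis
    by (subst (asm) sums_zero_iff_shift) auto
qed

text \<open>Common shape of the three series below: zeros, one exceptional value at the jump
  \<open>k\<close>, then a geometric tail.\<close>

lemma point_plus_geometric_tail_sums:
  fixes a :: real
  assumes "0 < a" "a < 1"
    and "\<And>z. z < k \<Longrightarrow> f z = 0" and "f k = c" and "\<And>z. k < z \<Longrightarrow> f z = w * a ^ (z - k)"
  shows "f sums (c + w * a / (1 - a))"
proof -
  \<comment> \<open>The tail starts at \<open>Suc k\<close> with the term \<open>w * a\<close>, so
    this factor is pulled out of a geometric series shifted by \<open>Suc k\<close>.\<close>
  have "(\<lambda>z. (if z = k then c else 0)
           + w * a * (if z < Suc k then 0 else a ^ (z - Suc k))) sums (c + w * a * (1 / (1 - a)))"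
    using assms by (intro sums_add sums_mult sums_single geometric_tail_sums)
  moreover have "(if z = k then c else 0)
      + w * a * (if z < Suc k then 0 else a ^ (z - Suc k)) = f z" for z
    using assms(3-5)
    by (cases z k rule: linorder_cases) (auto simp: Suc_diff_Suc power_Suc[symmetric] mult.assoc)
  ultimately show ?thesis
    by simp
qed

lemma little0_Jacobi_square_sums:
  assumes "0 < a" "a < 1"
  shows "(\<lambda>z. little0_Jacobi_coeff a b x x z * little0_Jacobi a b n z)
           sums (little0_Jacobi a b n x)\<^sup>2"
proof -
  define w where "w = origin_weight b x"
  define f where "f z = little0_Jacobi_coeff a b x x z * little0_Jacobi a b n z" for z
  note coeff = f_def little0_Jacobi_coeff_diag[OF assms(2)] w_def[symmetric]
  \<comment> \<open>The first case unites \<open>n = 0\<close> with a jump at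
    \<open>n - 1 < x\<close>; in the others the jump is at \<open>x\<close> or beyond it.\<close>
  consider "\<And>z. x \<le> z \<Longrightarrow> little0_Jacobi a b n z = 1" | "n = Suc x"
    | m where "n = Suc m" "x < m"
    by (cases n; cases "n - 1" x rule: linorder_cases)
      (force simp: little0_Jacobi_0 little0_Jacobi_Suc)+
  then have "f sums (little0_Jacobi a b n x)\<^sup>2"
  proof cases
    case 1
    \<comment> \<open>Only the total mass of the coefficients is summed here.\<close>
    have "f sums (1 - w * a / (1 - a) + w * a / (1 - a))"
      by (rule point_plus_geometric_tail_sums[OF assms, where k = x]) (auto simp: coeff 1)
    then show ?thesis
      by (simp add: 1)
  next
    case 2
    \<comment> \<open>With \<open>p = - (w * a / (1 - a))\<close> the value at \<open>x\<close>, the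
      diagonal coefficient is \<open>1 + p\<close> and the tail sums to \<open>- p\<close>, so the
      total is \<open>(1 + p) * p - p = p * p\<close>.\<close>
    have "f sums ((1 - w * a / (1 - a)) * - (w * a / (1 - a)) + w * a / (1 - a))"
      by (rule point_plus_geometric_tail_sums[OF assms, where k = x])
        (auto simp: coeff 2 little0_Jacobi_Suc)
    then show ?thesis
      by (simp add: 2 little0_Jacobi_Suc w_def power2_eq_square algebra_simps)
  next
    case 3
    then have m: "origin_weight b m = 1"
      by (simp add: origin_weight_def)
    \<comment> \<open>The terms before \<open>m\<close> vanish with the function, so the series
      starts at \<open>m\<close> rather than \<open>x\<close>. The jump value cancels the tail,
      matching the value \<open>0\<close> at \<open>x\<close>.\<close>
    have "f sums (w * a ^ (m - x) * - (a / (1 - a)) + w * a ^ (m - x) * a / (1 - a))"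
      using 3 by (intro point_plus_geometric_tail_sums[OF assms, where k = m])
        (auto simp: coeff little0_Jacobi_Suc m power_add[symmetric] mult.assoc)
    then show ?thesis
      using 3 by (simp add: little0_Jacobi_Suc)
  qed
  then show ?thesis
    by (simp add: f_def[abs_def])
qed

lemma little0_Jacobi_product_sums:
  assumes "0 < a" "a < 1"
  shows "(\<lambda>z. little0_Jacobi_coeff a b x y z * little0_Jacobi a b n z)
           sums (little0_Jacobi a b n x * little0_Jacobi a b n y)"
proof (cases "x = y")
  case True
  then show ?thesis
    using little0_Jacobi_square_sums[OF assms] by (simp add: power2_eq_square)
next
  case False
  then have "(\<lambda>z. little0_Jacobi_coeff a b x y z * little0_Jacobi a b n z)
      = (\<lambda>z. if z = min x y then little0_Jacobi a b n z else 0)"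
    by (auto simp: little0_Jacobi_coeff_def)
  then show ?thesis
    using sums_single[of "min x y" "little0_Jacobi a b n"] False
    by (simp add: little0_Jacobi_mult)
qed

text \<open>Only the entries with \<open>x = y = z\<close> can be negative. Those with
  \<open>x > 0\<close> all coincide, so testing at \<open>0\<close> and at \<open>1\<close>
  suffices, and each test yields one of the two bounds.\<close>

lemma little0_Jacobi_coeff_nonneg_iff:
  assumes "0 < a" "a < 1" "b < 1"
  shows "(\<forall>x y z. 0 \<le> little0_Jacobi_coeff a b x y z) \<longleftrightarrow> a \<le> 1 / 2 \<and> 2 - inverse a \<le> b"
proof -
  have b_iff: "0 \<le> 1 - 2 * a + a * b \<longleftrightarrow> 2 - inverse a \<le> b"
    using assms by (simp add: field_simps)
  show ?thesis
  proof
    assume nonneg: "\<forall>x y z. 0 \<le> little0_Jacobi_coeff a b x y z"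
    have "0 \<le> (1 - 2 * a) / (1 - a)" "0 \<le> (1 - 2 * a + a * b) / (1 - a)"
      using nonneg[rule_format, of 1 1 1] nonneg[rule_format, of 0 0 0]
      by (simp_all add: little0_Jacobi_coeff_def)
    then show "a \<le> 1 / 2 \<and> 2 - inverse a \<le> b"
      using assms b_iff by (simp add: zero_le_divide_iff)
  next
    assume "a \<le> 1 / 2 \<and> 2 - inverse a \<le> b"
    then show "\<forall>x y z. 0 \<le> little0_Jacobi_coeff a b x y z"
      using assms b_iff by (auto simp: little0_Jacobi_coeff_def)
  qed
qed

theorem theorem2p5:
  fixes a b :: real
  assumes "0 < a" and "a < 1" and "b < 1"
  shows "(\<forall>n x y. (\<lambda>z. little0_Jacobi_coeff a b x y z * little0_Jacobi a b n z)
            sums (little0_Jacobi a b n x * little0_Jacobi a b n y)) \<and>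
         (\<forall>n x y. x \<noteq> y \<longrightarrow>
            little0_Jacobi a b n x * little0_Jacobi a b n y = little0_Jacobi a b n (min x y)) \<and>
         ((\<forall>x y z. 0 \<le> little0_Jacobi_coeff a b x y z) \<longleftrightarrow>
            (0 < a \<and> a \<le> 1 / 2) \<and> (2 - inverse a \<le> b \<and> b < 1))"
  using assms little0_Jacobi_product_sums little0_Jacobi_mult little0_Jacobi_coeff_nonneg_iff
  by simp

end
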